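(* Let $n\ge2$. For every $A\in\mathcal{P}([n])$, the space $W_A$ satisfies $$W_A\cap\ker M_A=\{0\}\qquad\text{and}\qquad W_A\subset\bigcap_{\substack{B\in\mathcal{P}([n])\\ B\not\supset A}}\ker M_B .$$
   Context: Let $[n]=\{1,\dots,n\}$. For a finite set $E$, $\mathcal{P}(E)$ denotes the set of all subsets of $E$ with at least two elements, and $L(E)$ the real vector space of functions $E\to\mathbb{R}$; an element of $E$ is identified with its Dirac function in $L(E)$, and $\mathbf{1}_S$ is the indicator function of $S\subset E$. The symbol $\supset$ denotes non-strict inclusion; an intersection over an empty index set is $L(\mathfrak{S}_n)$. An injective word over $[n]$ is a finite sequence $\omega=\omega_1\cdots\omega_k$ of distinct elements of $[n]$ ($0\le k\le n$, the empty word being allowed); its content is $c(\omega)=\{\omega_1,\dots,\omega_k\}$. $\Gamma_n$ is the set of all injective words over $[n]$, and $\Gamma(A)=\{\omega\in\Gamma_n : c(\omega)=A\}$ for $A\subset[n]$; $L(\Gamma(A))$ is viewed as a subspace of $L(\Gamma_n)$. The symmetric group $\mathfrak{S}_n$ is identified, as a set, with $\Gamma([n])$ (a permutation $\sigma$ corresponds to the word $\sigma^{-1}(1)\cdots\sigma^{-1}(n)$). For $A\in\mathcal{P}([n])$ and a word $\sigma\in\Gamma([n])$, $\sigma_{|A}\in\Gamma(A)$ is the word obtained from $\sigma$ by deleting all letters not in $A$. The marginal operator $M_A:L(\mathfrak{S}_n)\to L(\Gamma(A))$ is the linear map with $M_A\sigma=\sigma_{|A}$ on Dirac functions. For $a\in[n]$,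 the deletion operator $\varrho_a:L(\Gamma_n)\to L(\Gamma_n)$ is the linear map sending the Dirac function of a word $\pi$ to that of the word obtained from $\pi$ by deleting the letter $a$ if $a\in c(\pi)$, and to that of $\pi$ itself otherwise. For $A\in\mathcal{P}([n])$, $$H_A=\{x\in L(\Gamma(A)) : \varrho_a(x)=0\text{ for all }a\in A\}.$$ For a word $\pi\in\Gamma_n$, $\mathfrak{S}_n[\pi]$ is the set of words $\sigma\in\Gamma([n])$ of the form $\sigma=\omega_1\pi\omega_2$ with $\omega_1,\omega_2\in\Gamma_n$. The linear operator $\phi_n:L(\Gamma_n)\to L(\mathfrak{S}_n)$ is defined on Dirac functions by $\phi_n\pi=\mathbf{1}_{\mathfrak{S}_n[\pi]}$, and $W_A:=\phi_n(H_A)\subset L(\mathfrak{S}_n)$. *)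

theory Defs
  imports Complex_Main "HOL-Library.Indicator_Function"
begin

definition subsets2 :: "'a set \<Rightarrow> 'a set set" where
  "subsets2 E = {S. S \<subseteq> E \<and> card S \<ge> 2}"

text \<open>
  The space \<open>L(E)\<close> of real functions on a finite set \<open>E\<close> is represented by the total functions
  that vanish outside \<open>E\<close>, so that \<open>L(E)\<close> is a subspace of \<open>L(F)\<close> for \<open>E \<subseteq> F\<close>. Vector space
  operations are pointwise and the zero vector is \<open>\<lambda>_. 0\<close>.
\<close>

definition fun_space :: "'a set \<Rightarrow> ('a \<Rightarrow> real) set" where
  "fun_space E = {x. \<forall>w. w \<notin> E \<longrightarrow> x w = 0}"

definition dirac :: "'a \<Rightarrow> 'a \<Rightarrow> real" where
  "dirac w = indicator {w}"

text \<open>The linear map on \<open>L(E)\<close>, \<open>E\<close> finite, with value \<open>f w\<close> at the Dirac function of \<open>w \<in> E\<close>.\<close>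

definition linear_ext :: "'a set \<Rightarrow> ('a \<Rightarrow> 'b \<Rightarrow> real) \<Rightarrow> ('a \<Rightarrow> real) \<Rightarrow> 'b \<Rightarrow> real" where
  "linear_ext E f x = (\<lambda>v. \<Sum>w\<in>E. x w * f w v)"

lemma linear_ext_dirac:
  assumes "finite E" "w \<in> E"
  shows "linear_ext E f (dirac w) = f w"
proof
  fix v
  have "linear_ext E f (dirac w) v = (\<Sum>u\<in>E. if u = w then f u v else 0)"
    unfolding linear_ext_def dirac_def by (intro sum.cong) (auto simp: indicator_def)
  then show "linear_ext E f (dirac w) v = f w v"
    using assms by simp
qed

definition inj_words :: "nat \<Rightarrow> nat list set" where
  "inj_words n = {\<omega>. distinct \<omega> \<and> set \<omega> \<subseteq> {1..n}}"

lemma finite_inj_words: "finite (inj_words n)"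
proof -
  have "inj_words n \<subseteq> {\<omega>. set \<omega> \<subseteq> {1..n} \<and> length \<omega> \<le> n}"
  proof
    fix \<omega> assume "\<omega> \<in> inj_words n"
    then have "distinct \<omega>" "set \<omega> \<subseteq> {1..n}"
      by (auto simp: inj_words_def)
    then show "\<omega> \<in> {\<omega>. set \<omega> \<subseteq> {1..n} \<and> length \<omega> \<le> n}"
      using card_mono[of "{1..n}" "set \<omega>"] distinct_card[of \<omega>] by simp
  qed
  then show ?thesis
    using finite_lists_length_le[of "{1..n}" n] finite_subset by blast
qed

definition words_on :: "nat \<Rightarrow> nat set \<Rightarrow> nat list set" where
  "words_on n A = {\<omega> \<in> inj_words n. set \<omega> = A}"

text \<open>A permutation \<open>\<sigma>\<close> of \<open>{1..n}\<close> is identified with the word \<open>\<sigma>\<^sup>-\<^sup>1(1) \<dots> \<sigma>\<^sup>-\<^sup>1(n)\<close>.\<close>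

definition perm_words :: "nat \<Rightarrow> nat list set" where
  "perm_words n = words_on n {1..n}"

definition marginal :: "nat \<Rightarrow> nat set \<Rightarrow> (nat list \<Rightarrow> real) \<Rightarrow> nat list \<Rightarrow> real" where
  "marginal n A = linear_ext (perm_words n) (\<lambda>\<sigma>. dirac (filter (\<lambda>i. i \<in> A) \<sigma>))"

definition ker_marginal :: "nat \<Rightarrow> nat set \<Rightarrow> (nat list \<Rightarrow> real) set" where
  "ker_marginal n A = {x \<in> fun_space (perm_words n). marginal n A x = (\<lambda>_. 0)}"

definition deletion :: "nat \<Rightarrow> nat \<Rightarrow> (nat list \<Rightarrow> real) \<Rightarrow> nat list \<Rightarrow> real" where
  "deletion n a = linear_ext (inj_words n) (\<lambda>\<pi>. dirac (removeAll a \<pi>))"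

definition H_space :: "nat \<Rightarrow> nat set \<Rightarrow> (nat list \<Rightarrow> real) set" where
  "H_space n A = {x \<in> fun_space (words_on n A). \<forall>a\<in>A. deletion n a x = (\<lambda>_. 0)}"

definition perm_words_containing :: "nat \<Rightarrow> nat list \<Rightarrow> nat list set" where
  "perm_words_containing n \<pi> =
     {\<sigma> \<in> perm_words n. \<exists>\<omega>\<^sub>1\<in>inj_words n. \<exists>\<omega>\<^sub>2\<in>inj_words n. \<sigma> = \<omega>\<^sub>1 @ \<pi> @ \<omega>\<^sub>2}"

definition phi :: "nat \<Rightarrow> (nat list \<Rightarrow> real) \<Rightarrow> nat list \<Rightarrow> real" where
  "phi n = linear_ext (inj_words n) (\<lambda>\<pi>. indicator (perm_words_containing n \<pi>))"

definition W_space :: "nat \<Rightarrow> nat set \<Rightarrow> (nat list \<Rightarrow> real) set" where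
  "W_space n A = phi n ` H_space n A"

end

theory Submission
  imports Defs
begin

text \<open>
  A permutation word containing \<open>\<pi> \<in> \<Gamma>(A)\<close> as a factor is \<open>u \<pi> w\<close> for a unique pair \<open>(u, w)\<close>, and the
  pairs that occur are the same for all \<open>\<pi>\<close>: those for which \<open>u w\<close> enumerates the complement of \<open>A\<close>.
  Hence, for \<open>x \<in> L(\<Gamma>(A))\<close>, the marginal of \<open>\<phi>\<^sub>n x\<close> on \<open>B\<close> is the sum over these frames \<open>(u, w)\<close> of
  the images of \<open>x\<close> under \<open>\<pi> \<mapsto> (u \<pi> w)\<^sub>|\<^sub>B\<close> (lemma \<open>marginal_phi\<close>). Two cases then give the result.

  For \<open>B = A\<close>, every frame is erased, so \<open>M\<^sub>A (\<phi>\<^sub>n x) = N x\<close>, where \<open>N > 0\<close> is the number of frames;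
  thus \<open>M\<^sub>A (\<phi>\<^sub>n x) = 0\<close> forces \<open>x = 0\<close> (lemma \<open>marginal_phi_self\<close>).

  If some \<open>a \<in> A\<close> is not in \<open>B\<close>, then \<open>(u \<pi> w)\<^sub>|\<^sub>B\<close> depends on \<open>\<pi>\<close> only through \<open>\<pi>\<close> with \<open>a\<close> deleted. For
  a fixed frame the contribution is therefore a linear image of \<open>\<rho>\<^sub>a x\<close>, which is zero
  for \<open>x \<in> H\<^sub>A\<close> (lemma \<open>marginal_phi_eq_0\<close>).
\<close>

definition frames :: "nat \<Rightarrow> nat set \<Rightarrow> (nat list \<times> nat list) set" where
  "frames n A = {(u, w). distinct (u @ w) \<and> set (u @ w) = {1..n} - A}"

lemma finite_frames: "finite (frames n A)"
proof (rule finite_subset)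
  show "frames n A \<subseteq> inj_words n \<times> inj_words n"
    by (auto simp: frames_def inj_words_def)
  show "finite (inj_words n \<times> inj_words n)"
    by (simp add: finite_inj_words)
qed

lemma frames_nonempty: "frames n A \<noteq> {}"
proof -
  have "([], sorted_list_of_set ({1..n} - A)) \<in> frames n A"
    by (simp add: frames_def)
  then show ?thesis by blast
qed

text \<open>
  A letter of \<open>\<pi>\<close> occurs nowhere else in a permutation word, so it fixes the position of the factor \<open>\<pi>\<close>.
  The empty word has to be excluded: it is a factor at several positions.
\<close>

lemma bij_betw_frames:
  assumes "\<pi> \<in> words_on n A" and "A \<noteq> {}"
  shows "bij_betw (\<lambda>(u, w). u @ \<pi> @ w) (frames n A) (perm_words_containing n \<pi>)"
  unfolding bij_betw_def
proof
  from assms obtain a p where \<pi>: "\<pi> = a # p" "a \<in> A" "set \<pi> = A" "distinct \<pi>" "A \<subseteq> {1..n}"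
    by (cases \<pi>) (auto simp: words_on_def inj_words_def)
  show "inj_on (\<lambda>(u, w). u @ \<pi> @ w) (frames n A)"
  proof (rule inj_onI, clarify)
    fix u w u' w'
    assume "(u, w) \<in> frames n A" "(u', w') \<in> frames n A" and eq: "u @ \<pi> @ w = u' @ \<pi> @ w'"
    then have a: "a \<notin> set u" "a \<notin> set u'"
      using \<pi>(2) by (auto simp: frames_def)
    have "takeWhile (\<lambda>b. b \<noteq> a) (u @ \<pi> @ w) = u" "takeWhile (\<lambda>b. b \<noteq> a) (u' @ \<pi> @ w') = u'"
      using a \<pi>(1) by (auto simp: takeWhile_append)
    then have "u = u'" using eq by simp
    then show "u = u' \<and> w = w'" using eq by simp
  qed
  show "(\<lambda>(u, w). u @ \<pi> @ w) ` frames n A = perm_words_containing n \<pi>"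
  proof (intro subset_antisym subsetI)
    fix \<sigma> assume "\<sigma> \<in> (\<lambda>(u, w). u @ \<pi> @ w) ` frames n A"
    then obtain u w where "(u, w) \<in> frames n A" "\<sigma> = u @ \<pi> @ w" by auto
    moreover from this have "u \<in> inj_words n" "w \<in> inj_words n"
      by (auto simp: frames_def inj_words_def)
    ultimately show "\<sigma> \<in> perm_words_containing n \<pi>"
      using \<pi>(3-5) by (auto simp: frames_def perm_words_containing_def perm_words_def words_on_def
          inj_words_def)
  next
    fix \<sigma> assume "\<sigma> \<in> perm_words_containing n \<pi>"
    then obtain u w where \<sigma>: "\<sigma> = u @ \<pi> @ w" and "distinct \<sigma>" "set \<sigma> = {1..n}"
      by (auto simp: perm_words_containing_def perm_words_def words_on_def inj_words_def)
    then have "(u, w) \<in> frames n A"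
      using \<pi>(3) by (auto simp: frames_def)
    then show "\<sigma> \<in> (\<lambda>(u, w). u @ \<pi> @ w) ` frames n A"
      using \<sigma> by force
  qed
qed

lemma perm_words_containing_subset: "perm_words_containing n \<pi> \<subseteq> perm_words n"
  by (auto simp: perm_words_containing_def)

lemma finite_perm_words: "finite (perm_words n)"
  by (rule finite_subset[OF _ finite_inj_words[of n]]) (auto simp: perm_words_def words_on_def)

lemma phi_in_fun_space: "phi n x \<in> fun_space (perm_words n)"
  using perm_words_containing_subset
  by (fastforce simp: fun_space_def phi_def linear_ext_def indicator_def intro: sum.neutral)

lemma marginal_phi:
  assumes x: "x \<in> fun_space (words_on n A)" and "A \<noteq> {}"
  shows "marginal n B (phi n x) v =
    (\<Sum>(u, w)\<in>frames n A. \<Sum>\<pi>\<in>inj_words n.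
       x \<pi> * dirac (filter (\<lambda>i. i \<in> B) (u @ \<pi> @ w)) v)"
proof -
  let ?d = "\<lambda>\<sigma>. dirac (filter (\<lambda>i. i \<in> B) \<sigma>) v"
  have inner: "x \<pi> * (\<Sum>\<sigma>\<in>perm_words n. indicator (perm_words_containing n \<pi>) \<sigma> * ?d \<sigma>)
      = x \<pi> * (\<Sum>(u, w)\<in>frames n A. ?d (u @ \<pi> @ w))" for \<pi>
  proof (cases "\<pi> \<in> words_on n A")
    case True
    have "(\<Sum>\<sigma>\<in>perm_words n. indicator (perm_words_containing n \<pi>) \<sigma> * ?d \<sigma>)
        = (\<Sum>\<sigma>\<in>perm_words_containing n \<pi>. ?d \<sigma>)"
      by (rule sum.mono_neutral_cong_right)
        (use perm_words_containing_subset[of n \<pi>] in \<open>auto simp: finite_perm_words\<close>)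
    also have "\<dots> = (\<Sum>(u, w)\<in>frames n A. ?d (u @ \<pi> @ w))"
      using sum.reindex_bij_betw[OF bij_betw_frames[OF True \<open>A \<noteq> {}\<close>], of ?d]
      by (simp add: case_prod_unfold)
    finally show ?thesis by simp
  next
    case False
    then show ?thesis using x by (simp add: fun_space_def)
  qed
  have "marginal n B (phi n x) v =
      (\<Sum>\<pi>\<in>inj_words n. x \<pi> *
        (\<Sum>\<sigma>\<in>perm_words n. indicator (perm_words_containing n \<pi>) \<sigma> * ?d \<sigma>))"
    unfolding marginal_def phi_def linear_ext_def sum_distrib_right sum_distrib_left
    by (subst sum.swap) (simp add: mult.assoc)
  also have "\<dots> = (\<Sum>\<pi>\<in>inj_words n. x \<pi> * (\<Sum>(u, w)\<in>frames n A. ?d (u @ \<pi> @ w)))"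
    by (simp only: inner)
  also have "\<dots> = (\<Sum>(u, w)\<in>frames n A. \<Sum>\<pi>\<in>inj_words n. x \<pi> * ?d (u @ \<pi> @ w))"
    unfolding sum_distrib_left case_prod_unfold by (rule sum.swap)
  finally show ?thesis .
qed

lemma marginal_phi_self:
  assumes x: "x \<in> fun_space (words_on n A)" and "A \<noteq> {}"
  shows "marginal n A (phi n x) v = real (card (frames n A)) * x v"
proof -
  have "(\<Sum>\<pi>\<in>inj_words n. x \<pi> * dirac (filter (\<lambda>i. i \<in> A) (u @ \<pi> @ w)) v) = x v"
    if "(u, w) \<in> frames n A" for u w
  proof -
    have erased: "filter (\<lambda>i. i \<in> A) u = []" "filter (\<lambda>i. i \<in> A) w = []"
      using that by (auto simp: frames_def filter_empty_conv)
    have "x \<pi> * dirac (filter (\<lambda>i. i \<in> A) (u @ \<pi> @ w)) v = (if \<pi> = v then x \<pi> else 0)" for \<pi>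
    proof (cases "\<pi> \<in> words_on n A")
      case True
      then have "filter (\<lambda>i. i \<in> A) \<pi> = \<pi>"
        by (auto simp: words_on_def filter_id_conv)
      then show ?thesis
        using erased by (auto simp: dirac_def indicator_def)
    next
      case False
      then have "x \<pi> = 0" using x by (simp add: fun_space_def)
      then show ?thesis by auto
    qed
    moreover have "v \<notin> inj_words n \<Longrightarrow> x v = 0"
      using x by (auto simp: fun_space_def words_on_def)
    ultimately show ?thesis
      by (simp add: finite_inj_words)
  qed
  then have "marginal n A (phi n x) v = (\<Sum>(u, w)\<in>frames n A. x v)"
    unfolding marginal_phi[OF assms] by (intro sum.cong) auto
  then show ?thesis by (simp add: case_prod_unfold)
qed

text \<open>
  The left-hand side is the pairing of \<open>h\<close> with \<open>\<rho>\<^sub>a x\<close>: group the words \<open>\<pi>\<close> by what is left after deleting \<open>a\<close>.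
\<close>

lemma sum_removeAll_eq_0:
  assumes "deletion n a x = (\<lambda>_. 0)"
  shows "(\<Sum>\<pi>\<in>inj_words n. x \<pi> * h (removeAll a \<pi>)) = 0"
proof -
  have "(\<Sum>\<pi>\<in>inj_words n. x \<pi> * h (removeAll a \<pi>))
      = (\<Sum>\<pi>\<in>inj_words n. \<Sum>\<tau>\<in>inj_words n. x \<pi> * dirac (removeAll a \<pi>) \<tau> * h \<tau>)"
  proof (rule sum.cong[OF refl])
    fix \<pi> assume "\<pi> \<in> inj_words n"
    then have "removeAll a \<pi> \<in> inj_words n"
      by (auto simp: inj_words_def distinct_removeAll)
    moreover have "x \<pi> * dirac (removeAll a \<pi>) \<tau> * h \<tau>
        = (if \<tau> = removeAll a \<pi> then x \<pi> * h \<tau> else 0)" for \<tau>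
      by (simp add: dirac_def)
    ultimately show "x \<pi> * h (removeAll a \<pi>)
        = (\<Sum>\<tau>\<in>inj_words n. x \<pi> * dirac (removeAll a \<pi>) \<tau> * h \<tau>)"
      by (simp add: finite_inj_words)
  qed
  also have "\<dots> = (\<Sum>\<tau>\<in>inj_words n. deletion n a x \<tau> * h \<tau>)"
    unfolding deletion_def linear_ext_def sum_distrib_right by (rule sum.swap)
  finally show ?thesis using assms by simp
qed

lemma marginal_phi_eq_0:
  assumes "x \<in> H_space n A" and "a \<in> A" and "a \<notin> B"
  shows "marginal n B (phi n x) v = 0"
proof -
  have x: "x \<in> fun_space (words_on n A)" "deletion n a x = (\<lambda>_. 0)" and "A \<noteq> {}"
    using assms(1,2) by (auto simp: H_space_def)
  have restrict: "filter (\<lambda>i. i \<in> B) \<pi> = filter (\<lambda>i. i \<in> B) (removeAll a \<pi>)" for \<pi>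
    using \<open>a \<notin> B\<close> by (induction \<pi>) auto
  have "(\<Sum>\<pi>\<in>inj_words n. x \<pi> * dirac (filter (\<lambda>i. i \<in> B) (u @ \<pi> @ w)) v) = 0" for u w
    using sum_removeAll_eq_0[OF x(2), of "\<lambda>\<tau>. dirac (filter (\<lambda>i. i \<in> B) (u @ \<tau> @ w)) v"]
    by (simp add: restrict[symmetric])
  then show ?thesis
    unfolding marginal_phi[OF x(1) \<open>A \<noteq> {}\<close>] by (simp add: case_prod_unfold)
qed

theorem proposition2:
  fixes n :: nat and A :: "nat set"
  assumes "n \<ge> 2" and "A \<in> subsets2 {1..n}"
  shows "W_space n A \<inter> ker_marginal n A = {\<lambda>_. 0} \<and>
    W_space n A \<subseteq> fun_space (perm_words n) \<inter>
      (\<Inter>B \<in> {B \<in> subsets2 {1..n}. \<not> A \<subseteq> B}. ker_marginal n B)"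
proof
  have "A \<noteq> {}" using assms(2) by (auto simp: subsets2_def)
  have phi_0: "phi n (\<lambda>_. 0) = (\<lambda>_. 0)"
    by (simp add: phi_def linear_ext_def)
  show "W_space n A \<inter> ker_marginal n A = {\<lambda>_. 0}"
  proof (intro subset_antisym subsetI)
    fix y assume "y \<in> W_space n A \<inter> ker_marginal n A"
    then obtain x where x: "x \<in> fun_space (words_on n A)" and y: "y = phi n x"
      and ker: "marginal n A (phi n x) = (\<lambda>_. 0)"
      by (auto simp: W_space_def ker_marginal_def H_space_def)
    have "card (frames n A) \<noteq> 0"
      by (simp add: finite_frames frames_nonempty)
    then have "x v = 0" for v
      using marginal_phi_self[OF x \<open>A \<noteq> {}\<close>, of v] ker by simp
    then have "x = (\<lambda>_. 0)" by blast
    then show "y \<in> {\<lambda>_. 0}" using y phi_0 by simp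
  next
    fix y :: "nat list \<Rightarrow> real" assume "y \<in> {\<lambda>_. 0}"
    moreover have "(\<lambda>_. 0) \<in> H_space n A"
      by (simp add: H_space_def fun_space_def deletion_def linear_ext_def)
    then have "(\<lambda>_. 0) \<in> W_space n A"
      unfolding W_space_def using phi_0 by (metis imageI)
    moreover have "(\<lambda>_. 0) \<in> ker_marginal n A"
      by (simp add: ker_marginal_def fun_space_def marginal_def linear_ext_def)
    ultimately show "y \<in> W_space n A \<inter> ker_marginal n A" by simp
  qed
  show "W_space n A \<subseteq> fun_space (perm_words n) \<inter>
      (\<Inter>B \<in> {B \<in> subsets2 {1..n}. \<not> A \<subseteq> B}. ker_marginal n B)"
  proof
    fix y assume "y \<in> W_space n A"
    then obtain x where x: "x \<in> H_space n A" and y: "y = phi n x"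
      by (auto simp: W_space_def)
    have "y \<in> ker_marginal n B" if "\<not> A \<subseteq> B" for B
    proof -
      from that obtain a where "a \<in> A" "a \<notin> B" by blast
      then have "marginal n B y = (\<lambda>_. 0)"
        unfolding y by (intro ext marginal_phi_eq_0[OF x])
      then show ?thesis
        using phi_in_fun_space by (simp add: ker_marginal_def y)
    qed
    then show "y \<in> fun_space (perm_words n) \<inter>
        (\<Inter>B \<in> {B \<in> subsets2 {1..n}. \<not> A \<subseteq> B}. ker_marginal n B)"
      using phi_in_fun_space y by auto
  qed
qed

end
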